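(* Let $A[x,\sigma]$ be a Hopf-Ore extension of a Hopf algebra $A$, with associated grouplike $g\in G(A)$ and character $\chi$, and let $R$ be an algebra. Let $\cdot:A[x,\sigma]\otimes R\to R$ be a linear map such that $x\cdot1_R\in Z(R)$, $g\cdot1_R=0$, and $ga\cdot r=ag\cdot r$ for all $a\in A$, $r\in R$. Then $\cdot$ is a partial action (respectively, a symmetric partial action) of $A[x,\sigma]$ on $R$ if and only if all of the following hold: (1) the restriction $\cdot|_{A\otimes R}$ is a partial action (respectively, a symmetric partial action) of $A$ on $R$; (2) $a\cdot(x\cdot1_R)=(\sigma^{-1}(a)\cdot1_R)(x\cdot1_R)$ for all $a\in A$; (3) for all $a\in A$, $r\in R$, $j\in\mathbb{N}_0$, with $q=\chi(g)$ and $w=x\cdot1_R$, $$x^ja\cdot r=\sum_{k=0}^{j}(-1)^kq^{-\frac{k(k-1)}{2}}\binom{j}{k}_{q^{-1}}w^{j-k}(g^ka\cdot r)w^k.$$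
   Context: $\Bbbk$ is an algebraically closed field of characteristic zero; all algebras are associative unital $\Bbbk$-algebras. Sweedler notation $\Delta(h)=h_1\otimes h_2$ is used; $G(A)$ is the group of grouplike elements of $A$ and $Z(R)$ is the center of $R$. A (left) partial action of a Hopf algebra $\mathcal{H}$ on an algebra $R$ is a linear map $\cdot:\mathcal{H}\otimes R\to R$, $h\otimes r\mapsto h\cdot r$, such that for all $h,k\in\mathcal{H}$, $r,s\in R$: (PA.1) $1_{\mathcal H}\cdot r=r$; (PA.2) $h\cdot (rs)=(h_1\cdot r)(h_2\cdot s)$; (PA.3) $h\cdot(k\cdot r)=(h_1\cdot 1_R)(h_2k\cdot r)$. It is symmetric if in addition (PA.S) $h\cdot(k\cdot r)=(h_1k\cdot r)(h_2\cdot1_R)$. Hopf-Ore extension: let $A$ be a Hopf algebra, $g\in G(A)$, $\chi:A\to\Bbbk$ a character (algebra map) and $\sigma$ an algebra automorphism of $A$ with $\sigma(a)=\chi(a_1)a_2=ga_1g^{-1}\chi(a_2)$ for all $a\in A$. $A[x,\sigma]$ is the algebra generated by $A$ and a variable $x$ subject to $xa=\sigma(a)x$ for $a\in A$, with the Hopf algebra structure extending that of $A$ such that $\Delta(x)=x\otimes 1+g\otimes x$. Every element is uniquely of the form $\sum_{i\ge0} x^ia_i$ with $a_i\in A$. $q$-binomial coefficients: $\binom{0}{0}_q=1$, $\binom{n}{m}_q=0$ if $m>n$ or $m<0$, and $\binom{n}{m}_q=\binom{n-1}{m}_q+q^{n-m}\binom{n-1}{m-1}_q$ for $n\ge1$,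 $0\le m\le n$. *)

theory Defs
  imports "HOL-Computational_Algebra.Polynomial"
begin

section \<open>Algebras over a field\<close>

text \<open>
  The sort \<open>{ring, monoid_mult}\<close> is \<open>ring_1\<close> without \<open>0 \<noteq> 1\<close>, so that the zero algebra is
  not excluded. The scalar action is explicit, because several algebras over the same field occur.
\<close>

locale k_algebra = vector_space s
  for s :: "'k::field \<Rightarrow> 'a::{ring, monoid_mult} \<Rightarrow> 'a" +
  assumes scale_mult_left: "s c a * b = s c (a * b)"
    and scale_mult_right: "a * s c b = s c (a * b)"

locale k_algebra_hom = Vector_Spaces.linear s t f
  for s :: "'k::field \<Rightarrow> 'a::{ring, monoid_mult} \<Rightarrow> 'a"
    and t :: "'k \<Rightarrow> 'b::{ring, monoid_mult} \<Rightarrow> 'b"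
    and f :: "'a \<Rightarrow> 'b" +
  assumes hom_one: "f 1 = 1"
    and hom_mult: "f (a * b) = f a * f b"

definition bilinear_map ::
  "('k::field \<Rightarrow> 'a::ab_group_add \<Rightarrow> 'a) \<Rightarrow> ('k \<Rightarrow> 'b::ab_group_add \<Rightarrow> 'b) \<Rightarrow>
   ('k \<Rightarrow> 'c::ab_group_add \<Rightarrow> 'c) \<Rightarrow> ('a \<Rightarrow> 'b \<Rightarrow> 'c) \<Rightarrow> bool"
  where "bilinear_map s t u f \<longleftrightarrow>
    (\<forall>b. Vector_Spaces.linear s u (\<lambda>a. f a b)) \<and> (\<forall>a. Vector_Spaces.linear t u (f a))"


section \<open>Tensor products\<close>

text \<open>
  An element of a tensor product is written as a finite formal sum of pure tensors, i.e. as a list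
  of pairs (or triples); the scalars are absorbed into the factors. The tensor product itself is
  the quotient by the congruence generated by commutativity of the formal sum and the usual
  multilinearity relations, so \<open>tensor_eq\<close> and \<open>tensor3_eq\<close> are the equality in \<open>A \<otimes> B\<close> and in
  \<open>A \<otimes> A \<otimes> A\<close>.
\<close>

inductive formal_sum_cong :: "('x list \<Rightarrow> 'x list \<Rightarrow> bool) \<Rightarrow> 'x list \<Rightarrow> 'x list \<Rightarrow> bool"
  for rel :: "'x list \<Rightarrow> 'x list \<Rightarrow> bool"
  where
    base: "rel u v \<Longrightarrow> formal_sum_cong rel u v"
  | refl: "formal_sum_cong rel u u"
  | sym: "formal_sum_cong rel u v \<Longrightarrow> formal_sum_cong rel v u"
  | trans: "formal_sum_cong rel u v \<Longrightarrow> formal_sum_cong rel v w \<Longrightarrow> formal_sum_cong rel u w"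
  | plus: "formal_sum_cong rel u u' \<Longrightarrow> formal_sum_cong rel v v' \<Longrightarrow>
      formal_sum_cong rel (u @ v) (u' @ v')"
  | comm: "formal_sum_cong rel (u @ v) (v @ u)"

inductive tensor_rel ::
  "('k \<Rightarrow> 'a::ab_group_add \<Rightarrow> 'a) \<Rightarrow> ('k \<Rightarrow> 'b::ab_group_add \<Rightarrow> 'b) \<Rightarrow>
   ('a \<times> 'b) list \<Rightarrow> ('a \<times> 'b) list \<Rightarrow> bool"
  for s :: "'k \<Rightarrow> 'a \<Rightarrow> 'a" and t :: "'k \<Rightarrow> 'b \<Rightarrow> 'b"
  where
    add_left: "tensor_rel s t [(a + a', b)] [(a, b), (a', b)]"
  | add_right: "tensor_rel s t [(a, b + b')] [(a, b), (a, b')]"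
  | zero_left: "tensor_rel s t [(0, b)] []"
  | zero_right: "tensor_rel s t [(a, 0)] []"
  | balanced: "tensor_rel s t [(s c a, b)] [(a, t c b)]"

abbreviation tensor_eq where "tensor_eq s t \<equiv> formal_sum_cong (tensor_rel s t)"

inductive tensor3_rel ::
  "('k \<Rightarrow> 'a::ab_group_add \<Rightarrow> 'a) \<Rightarrow>
   ('a \<times> 'a \<times> 'a) list \<Rightarrow> ('a \<times> 'a \<times> 'a) list \<Rightarrow> bool"
  for s :: "'k \<Rightarrow> 'a \<Rightarrow> 'a"
  where
    add_1: "tensor3_rel s [(a + a', b, c)] [(a, b, c), (a', b, c)]"
  | add_2: "tensor3_rel s [(a, b + b', c)] [(a, b, c), (a, b', c)]"
  | add_3: "tensor3_rel s [(a, b, c + c')] [(a, b, c), (a, b, c')]"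
  | zero_1: "tensor3_rel s [(0, b, c)] []"
  | zero_2: "tensor3_rel s [(a, 0, c)] []"
  | zero_3: "tensor3_rel s [(a, b, 0)] []"
  | balanced_12: "tensor3_rel s [(s l a, b, c)] [(a, s l b, c)]"
  | balanced_23: "tensor3_rel s [(a, s l b, c)] [(a, b, s l c)]"

abbreviation tensor3_eq where "tensor3_eq s \<equiv> formal_sum_cong (tensor3_rel s)"

lemma sum_list_formal_sum_cong:
  fixes f :: "'x \<Rightarrow> 'c::comm_monoid_add"
  assumes "formal_sum_cong rel u v"
    and "\<And>u v. rel u v \<Longrightarrow> sum_list (map f u) = sum_list (map f v)"
  shows "sum_list (map f u) = sum_list (map f v)"
  using assms(1) by induction (auto simp: assms(2) add.commute)

text \<open>
  A bilinear map factors through the tensor product. Hence the Sweedler sums below, which are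
  sums over a representing list, do not depend on the representative.
\<close>

lemma sum_list_tensor_eq:
  assumes f: "bilinear_map s t r f" and uv: "tensor_eq s t u v"
  shows "(\<Sum>(a, b)\<leftarrow>u. f a b) = (\<Sum>(a, b)\<leftarrow>v. f a b)"
proof (rule sum_list_formal_sum_cong[OF uv])
  have l: "Vector_Spaces.linear s r (\<lambda>a. f a b)" for b
    using f by (simp add: bilinear_map_def)
  have r: "Vector_Spaces.linear t r (f a)" for a
    using f by (simp add: bilinear_map_def)
  note hom = Vector_Spaces.linear.axioms(3)
  note simps = module_hom.add[OF hom[OF l]] module_hom.add[OF hom[OF r]]
    module_hom.scale[OF hom[OF l]] module_hom.scale[OF hom[OF r]]
    module_hom.zero[OF hom[OF l]] module_hom.zero[OF hom[OF r]]
  fix u v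
  assume "tensor_rel s t u v"
  then show "(\<Sum>(a, b)\<leftarrow>u. f a b) = (\<Sum>(a, b)\<leftarrow>v. f a b)"
    by cases (simp_all add: simps)
qed


section \<open>Hopf algebras\<close>

text \<open>
  \<open>comult H h\<close> is a list of pairs representing \<open>\<Delta>(h) \<in> H \<otimes> H\<close>; running over it is Sweedler
  notation. All conditions on \<open>\<Delta>\<close> are imposed up to equality of tensors, so the choice of
  representatives is arbitrary.
\<close>

record ('k, 'h) hopf_struct =
  scl :: "'k \<Rightarrow> 'h \<Rightarrow> 'h"
  comult :: "'h \<Rightarrow> ('h \<times> 'h) list"
  counit :: "'h \<Rightarrow> 'k"
  antipode :: "'h \<Rightarrow> 'h"

locale hopf_algebra = k_algebra "scl H"
  for H :: "('k::field, 'h::{ring, monoid_mult}) hopf_struct" +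
  assumes comult_add:
      "tensor_eq (scl H) (scl H) (comult H (a + b)) (comult H a @ comult H b)"
    and comult_scale:
      "tensor_eq (scl H) (scl H) (comult H (scl H c a)) [(scl H c a1, a2). (a1, a2) \<leftarrow> comult H a]"
    and comult_one:
      "tensor_eq (scl H) (scl H) (comult H 1) [(1, 1)]"
    and comult_mult:
      "tensor_eq (scl H) (scl H) (comult H (a * b))
         [(a1 * b1, a2 * b2). (a1, a2) \<leftarrow> comult H a, (b1, b2) \<leftarrow> comult H b]"
    and counit_hom: "k_algebra_hom (scl H) (*) (counit H)"
    and coassoc:
      "tensor3_eq (scl H)
         [(b1, b2, a2). (a1, a2) \<leftarrow> comult H a, (b1, b2) \<leftarrow> comult H a1]
         [(a1, b1, b2). (a1, a2) \<leftarrow> comult H a, (b1, b2) \<leftarrow> comult H a2]"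
    and counit_left: "(\<Sum>(a1, a2)\<leftarrow>comult H a. scl H (counit H a1) a2) = a"
    and counit_right: "(\<Sum>(a1, a2)\<leftarrow>comult H a. scl H (counit H a2) a1) = a"
    and antipode_linear: "Vector_Spaces.linear (scl H) (scl H) (antipode H)"
    and antipode_left: "(\<Sum>(a1, a2)\<leftarrow>comult H a. antipode H a1 * a2) = scl H (counit H a) 1"
    and antipode_right: "(\<Sum>(a1, a2)\<leftarrow>comult H a. a1 * antipode H a2) = scl H (counit H a) 1"

definition grouplike :: "('k::field, 'h::{ring, monoid_mult}) hopf_struct \<Rightarrow> 'h \<Rightarrow> bool"
  where "grouplike H g \<longleftrightarrow>
    tensor_eq (scl H) (scl H) (comult H g) [(g, g)] \<and> counit H g = 1"

text \<open>Meaningful for units only; grouplike elements of a Hopf algebra are units.\<close>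

definition unit_inverse :: "'a::{ring, monoid_mult} \<Rightarrow> 'a"
  where "unit_inverse g = (THE h. g * h = 1 \<and> h * g = 1)"

locale hopf_hom = k_algebra_hom "scl A" "scl H" f
  for A :: "('k::field, 'a::{ring, monoid_mult}) hopf_struct"
    and H :: "('k, 'h::{ring, monoid_mult}) hopf_struct"
    and f :: "'a \<Rightarrow> 'h" +
  assumes hom_comult:
      "tensor_eq (scl H) (scl H) (comult H (f a)) [(f a1, f a2). (a1, a2) \<leftarrow> comult A a]"
    and hom_counit: "counit H (f a) = counit A a"
    and hom_antipode: "antipode H (f a) = f (antipode A a)"


section \<open>Hopf-Ore extensions\<close>

text \<open>
  \<open>H\<close> is \<open>A[x, \<sigma>]\<close>, where \<open>\<iota>\<close> is the inclusion of \<open>A\<close>. The relation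
  \<open>x a = \<sigma>(a) x\<close> together with the unique normal form determines the algebra \<open>A[x, \<sigma>]\<close> up to
  isomorphism; injectivity of \<open>\<iota>\<close> is part of the uniqueness of the normal form.
\<close>

locale hopf_ore_extension =
  A: hopf_algebra A + H: hopf_algebra H + hopf_hom A H \<iota>
  for A :: "('k::field, 'a::{ring, monoid_mult}) hopf_struct"
    and H :: "('k, 'h::{ring, monoid_mult}) hopf_struct"
    and \<iota> :: "'a \<Rightarrow> 'h" +
  fixes g :: 'a and \<chi> :: "'a \<Rightarrow> 'k" and \<sigma> :: "'a \<Rightarrow> 'a" and x :: 'h
  assumes g_grouplike: "grouplike A g"
    and \<chi>_character: "k_algebra_hom (scl A) (*) \<chi>"
    and \<sigma>_hom: "k_algebra_hom (scl A) (scl A) \<sigma>"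
    and \<sigma>_bij: "bij \<sigma>"
    and \<sigma>_left: "\<sigma> a = (\<Sum>(a1, a2)\<leftarrow>comult A a. scl A (\<chi> a1) a2)"
    and \<sigma>_right: "\<sigma> a = (\<Sum>(a1, a2)\<leftarrow>comult A a. scl A (\<chi> a2) (g * a1 * unit_inverse g))"
    and ore_relation: "x * \<iota> a = \<iota> (\<sigma> a) * x"
    and normal_form: "\<exists>!c :: nat \<Rightarrow> 'a. finite {i. c i \<noteq> 0} \<and> h = (\<Sum>i | c i \<noteq> 0. x ^ i * \<iota> (c i))"
    and comult_x: "tensor_eq (scl H) (scl H) (comult H x) [(x, 1), (\<iota> g, x)]"


section \<open>Partial actions\<close>

text \<open>The linear map \<open>H \<otimes> R \<rightarrow> R\<close> is given as a bilinear map \<open>act\<close>.\<close>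

definition partial_action ::
  "('k::field, 'h::{ring, monoid_mult}) hopf_struct \<Rightarrow>
   ('k \<Rightarrow> 'r::{ring, monoid_mult} \<Rightarrow> 'r) \<Rightarrow> ('h \<Rightarrow> 'r \<Rightarrow> 'r) \<Rightarrow> bool"
  where "partial_action H sR act \<longleftrightarrow>
    bilinear_map (scl H) sR sR act \<and>
    (\<forall>r. act 1 r = r) \<and>
    (\<forall>h r s. act h (r * s) = (\<Sum>(h1, h2)\<leftarrow>comult H h. act h1 r * act h2 s)) \<and>
    (\<forall>h k r. act h (act k r) = (\<Sum>(h1, h2)\<leftarrow>comult H h. act h1 1 * act (h2 * k) r))"

definition symmetric_partial_action ::
  "('k::field, 'h::{ring, monoid_mult}) hopf_struct \<Rightarrow>
   ('k \<Rightarrow> 'r::{ring, monoid_mult} \<Rightarrow> 'r) \<Rightarrow> ('h \<Rightarrow> 'r \<Rightarrow> 'r) \<Rightarrow> bool"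
  where "symmetric_partial_action H sR act \<longleftrightarrow>
    partial_action H sR act \<and>
    (\<forall>h k r. act h (act k r) = (\<Sum>(h1, h2)\<leftarrow>comult H h. act (h1 * k) r * act h2 1))"


section \<open>Gaussian binomial coefficients\<close>

fun qbinomial :: "'k::comm_ring_1 \<Rightarrow> nat \<Rightarrow> nat \<Rightarrow> 'k"
  where
    "qbinomial q 0 0 = 1"
  | "qbinomial q 0 (Suc m) = 0"
  | "qbinomial q (Suc n) 0 = qbinomial q n 0"
  | "qbinomial q (Suc n) (Suc m) =
      (if m > n then 0 else qbinomial q n (Suc m) + q ^ (n - m) * qbinomial q n m)"

end

theory Submission
  imports Defs
begin

text \<open>
Write \<open>h \<cdot> r\<close> for \<open>act h r\<close>, \<open>w = x \<cdot> 1\<close> and \<open>q = \<chi> g\<close>. The proof replaces the formula for \<open>x\<^sup>j a \<cdot> r\<close> by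
its case \<open>j = 1\<close>, taken over all of the Hopf-Ore extension:
\<open>x k \<cdot> r = w (k \<cdot> r) - (g k \<cdot> r) w\<close> for every \<open>k\<close>, called \<open>skew_commutator\<close> below. Since
\<open>g x\<^sup>j a = q\<^sup>-\<^sup>j x\<^sup>j g a\<close>, iterating this law gives a recursion in \<open>j\<close> that is solved by the Gaussian
coefficients, and conversely two consecutive values of \<open>j\<close> in the formula give the law back
(\<open>skew_commutator_iff_formula\<close>).

Necessity (\<open>partial_action_skew_commutator\<close>). The expansion of \<open>x \<cdot> (k \<cdot> r)\<close> yields nothing, because
\<open>g \<cdot> 1 = 0\<close> kills the term with \<open>x k\<close>. The element \<open>y = g\<^sup>-\<^sup>1 x\<close> does better: its comultiplication
\<open>y \<otimes> g\<^sup>-\<^sup>1 + 1 \<otimes> y\<close> turns the composition law for \<open>y\<close> and \<open>g k\<close> into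
\<open>y \<cdot> (g k \<cdot> r) = (y \<cdot> 1)(k \<cdot> r) + q (x k \<cdot> r)\<close>. Moreover \<open>g \<cdot> r = 0\<close> for all \<open>r\<close>, hence
\<open>0 = g\<^sup>-\<^sup>1 \<cdot> (g \<cdot> 1) = g\<^sup>-\<^sup>1 \<cdot> 1\<close>; so \<open>y\<close> acts by \<open>y \<cdot> s = - q s w\<close> and the law follows. The condition on
\<open>a \<cdot> w\<close> is then the composition law for \<open>a\<close> and \<open>x\<close>, read through the two descriptions of \<open>\<sigma>\<close>.

Sufficiency. All three axioms equate some \<open>h \<cdot> t\<close> with a Sweedler sum over \<open>\<Delta>(h)\<close> of products
\<open>(h\<^sub>1 b \<cdot> r)(h\<^sub>2 c \<cdot> s)\<close>. Under the skew commutator law and with \<open>w\<close> central, both sides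
change in the same way when \<open>h\<close> is replaced by \<open>x h\<close> (\<open>sweedler_act_x_mult\<close>: the mixed terms cancel),
so it suffices to let \<open>h\<close> range over \<open>A\<close>. For the composition laws \<open>a \<cdot> (k \<cdot> r)\<close> this still
leaves an arbitrary \<open>k\<close>, which is treated by induction on its degree in \<open>x\<close>
(\<open>composition_law_base\<close>, \<open>symmetric_composition_law_base\<close>).
\<close>

section \<open>Sweedler sums\<close>

lemma linear_mapI:
  assumes "vector_space s" "vector_space t"
    and "\<And>a b. f (a + b) = f a + f b" "\<And>c a. f (s c a) = t c (f a)"
  shows "Vector_Spaces.linear s t f"
  using assms unfolding Vector_Spaces.linear_iff by blast

lemma linear_scale_map:
  assumes "vector_space t"
  shows "Vector_Spaces.linear t t (t c)"
proof -
  interpret vector_space t by fact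
  show ?thesis
    by (rule linear_mapI) (auto simp: scale_right_distrib vector_space_axioms mult.commute)
qed

lemma bilinear_mapI:
  assumes "vector_space s" "vector_space t" "vector_space u"
    and "\<And>a a' b. f (a + a') b = f a b + f a' b" "\<And>c a b. f (s c a) b = u c (f a b)"
    and "\<And>a b b'. f a (b + b') = f a b + f a b'" "\<And>c a b. f a (t c b) = u c (f a b)"
  shows "bilinear_map s t u f"
  using assms by (auto simp: bilinear_map_def intro!: linear_mapI)

lemma bilinear_mapD:
  assumes "bilinear_map s t u f"
  shows "vector_space s" "vector_space t" "vector_space u"
    and "f (a + a') b = f a b + f a' b" "f (s c a) b = u c (f a b)"
    and "f a (b + b') = f a b + f a b'" "f a (t c b) = u c (f a b)"
  using assms unfolding bilinear_map_def Vector_Spaces.linear_iff by auto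

lemma sum_list_concat_map:
  fixes f :: "'b \<Rightarrow> 'c::comm_monoid_add"
  shows "sum_list (map f (concat (map h xs))) = (\<Sum>y\<leftarrow>xs. sum_list (map f (h y)))"
  by (induction xs) auto

definition sweedler ::
  "('k::field, 'h::{ring, monoid_mult}) hopf_struct \<Rightarrow> ('h \<Rightarrow> 'h \<Rightarrow> 'c::comm_monoid_add) \<Rightarrow> 'h \<Rightarrow> 'c"
  where "sweedler H f h = (\<Sum>(h1, h2)\<leftarrow>comult H h. f h1 h2)"

lemma sweedler_mult_left:
  fixes c :: "'r::{ring, monoid_mult}"
  shows "c * sweedler H f h = sweedler H (\<lambda>h1 h2. c * f h1 h2) h"
  by (simp add: sweedler_def sum_list_const_mult[symmetric] case_prod_unfold)

lemma sweedler_zero [simp]: "sweedler H (\<lambda>h1 h2. 0) h = 0"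
  by (simp add: sweedler_def case_prod_unfold)

lemma sweedler_add: "sweedler H (\<lambda>h1 h2. f h1 h2 + f' h1 h2) h = sweedler H f h + sweedler H f' h"
  by (simp add: sweedler_def sum_list_addf case_prod_unfold)

lemma sweedler_diff:
  fixes f :: "'h::{ring, monoid_mult} \<Rightarrow> 'h \<Rightarrow> 'c::ab_group_add"
  shows "sweedler H (\<lambda>h1 h2. f h1 h2 - f' h1 h2) h = sweedler H f h - sweedler H f' h"
  by (simp add: sweedler_def sum_list_subtractf case_prod_unfold)

lemma sweedler_linear_image:
  assumes "Vector_Spaces.linear s t F"
  shows "F (sweedler H f h) = sweedler H (\<lambda>h1 h2. F (f h1 h2)) h"
proof -
  interpret F: Vector_Spaces.linear s t F by fact
  have "F (\<Sum>p\<leftarrow>xs. case p of (h1, h2) \<Rightarrow> f h1 h2) = (\<Sum>(h1, h2)\<leftarrow>xs. F (f h1 h2))" for xs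
    by (induction xs) (auto simp: F.zero F.add)
  then show ?thesis by (simp add: sweedler_def)
qed

definition trilinear_map where
  "trilinear_map s t f \<longleftrightarrow> (\<forall>c. bilinear_map s s t (\<lambda>a b. f a b c)) \<and> (\<forall>a. bilinear_map s s t (f a))"

text \<open>
The universal property of \<open>A \<otimes> A \<otimes> A\<close>; it makes coassociativity usable inside iterated Sweedler sums.
\<close>

lemma sum_list_tensor3_eq:
  assumes f: "trilinear_map s t f" and uv: "tensor3_eq s u v"
  shows "(\<Sum>(a, b, c)\<leftarrow>u. f a b c) = (\<Sum>(a, b, c)\<leftarrow>v. f a b c)"
proof (rule sum_list_formal_sum_cong[OF uv])
  have f1: "bilinear_map s s t (\<lambda>a b. f a b c)" and f2: "bilinear_map s s t (f a)" for a c
    using f by (auto simp: trilinear_map_def)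
  note add = bilinear_mapD(4)[OF f1] bilinear_mapD(4,6)[OF f2]
  have zero: "f 0 b c = 0" "f a 0 c = 0" "f a b 0 = 0" for a b c
    using add(1)[of 0 0 b c] add(2)[of a 0 0 c] add(3)[of a b 0 0] by simp_all
  fix u v
  assume "tensor3_rel s u v"
  then show "(\<Sum>(a, b, c)\<leftarrow>u. f a b c) = (\<Sum>(a, b, c)\<leftarrow>v. f a b c)"
    by cases (simp_all add: add zero bilinear_mapD(5,7)[OF f1] bilinear_mapD(5,7)[OF f2])
qed

context hopf_algebra
begin

abbreviation bilin where "bilin t f \<equiv> bilinear_map (scl H) (scl H) t f"

lemma sweedler_cong_tensor:
  assumes "bilin t f" "tensor_eq (scl H) (scl H) (comult H h) u"
  shows "sweedler H f h = (\<Sum>(a, b)\<leftarrow>u. f a b)"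
  unfolding sweedler_def using sum_list_tensor_eq[OF assms] .

lemma sweedler_one: "bilin t f \<Longrightarrow> sweedler H f 1 = f 1 1"
  using sweedler_cong_tensor[of t f 1 "[(1, 1)]"] comult_one by simp

lemma sweedler_grouplike: "bilin t f \<Longrightarrow> grouplike H h \<Longrightarrow> sweedler H f h = f h h"
  using sweedler_cong_tensor[of t f h "[(h, h)]"] by (simp add: grouplike_def)

lemma sweedler_plus:
  assumes "bilin t f"
  shows "sweedler H f (h + k) = sweedler H f h + sweedler H f k"
  using sweedler_cong_tensor[OF assms comult_add] by (simp add: sweedler_def)

lemma sweedler_scale:
  assumes "bilin t f"
  shows "sweedler H f (scl H c h) = t c (sweedler H f h)"
proof -
  interpret t: vector_space t using assms by (rule bilinear_mapD)
  have "(\<Sum>(a, b)\<leftarrow>xs. t c (f a b)) = t c (\<Sum>(a, b)\<leftarrow>xs. f a b)" for xs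
    by (induction xs) (auto simp: t.scale_right_distrib)
  then show ?thesis
    using sweedler_cong_tensor[OF assms comult_scale, of c h]
    by (simp add: sweedler_def case_prod_unfold o_def bilinear_mapD(5)[OF assms])
qed

lemma sweedler_linear: "bilin t f \<Longrightarrow> Vector_Spaces.linear (scl H) t (sweedler H f)"
  by (rule linear_mapI) (auto simp: sweedler_plus sweedler_scale dest: bilinear_mapD(3) intro: vector_space_axioms)

lemma sweedler_mult:
  assumes "bilin t f"
  shows "sweedler H f (h * k) = sweedler H (\<lambda>h1 h2. sweedler H (\<lambda>k1 k2. f (h1 * k1) (h2 * k2)) k) h"
  using sweedler_cong_tensor[OF assms comult_mult, of h k]
  by (simp add: sweedler_def sum_list_concat_map case_prod_unfold o_def)

lemma bilin_mult:
  assumes "bilin t f"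
  shows "bilin t (\<lambda>k1 k2. f (a * k1 * a') (b * k2 * b'))"
  by (rule bilinear_mapI)
     (simp_all add: bilinear_mapD[OF assms] vector_space_axioms ring_distribs scale_mult_left scale_mult_right)

lemma bilin_mult_left: "bilin t f \<Longrightarrow> bilin t (\<lambda>k1 k2. f (a * k1) (b * k2))"
  using bilin_mult[of t f a 1 b 1] by simp

lemma bilin_sweedler_mult:
  assumes "bilin t f"
  shows "bilin t (\<lambda>h1 h2. sweedler H (\<lambda>k1 k2. f (h1 * k1) (h2 * k2)) k)"
proof (rule bilinear_mapI)
  interpret t: vector_space t using assms by (rule bilinear_mapD)
  fix c
  note T = sweedler_linear_image[OF linear_scale_map[OF t.vector_space_axioms]]
  show "sweedler H (\<lambda>k1 k2. f (scl H c a * k1) (b * k2)) k = t c (sweedler H (\<lambda>k1 k2. f (a * k1) (b * k2)) k)"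
    "sweedler H (\<lambda>k1 k2. f (a * k1) (scl H c b * k2)) k = t c (sweedler H (\<lambda>k1 k2. f (a * k1) (b * k2)) k)" for a b
    by (simp_all add: T scale_mult_left bilinear_mapD[OF assms])
qed (simp_all add: bilinear_mapD[OF assms] vector_space_axioms ring_distribs sweedler_add)

lemma sweedler_mult_grouplike:
  assumes "bilin t f" "grouplike H u"
  shows "sweedler H f (u * k) = sweedler H (\<lambda>k1 k2. f (u * k1) (u * k2)) k"
  unfolding sweedler_mult[OF assms(1)]
  by (rule sweedler_grouplike[OF bilin_sweedler_mult[OF assms(1)] assms(2)])

lemma sweedler_mult_grouplike_right:
  assumes "bilin t f" "grouplike H u"
  shows "sweedler H f (k * u) = sweedler H (\<lambda>k1 k2. f (k1 * u) (k2 * u)) k"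
  unfolding sweedler_mult[OF assms(1)]
  using sweedler_grouplike[OF bilin_mult_left[OF assms(1)] assms(2)] by simp

lemma sweedler_coassoc:
  assumes "trilinear_map (scl H) t f"
  shows "sweedler H (\<lambda>a1 a2. sweedler H (\<lambda>b1 b2. f b1 b2 a2) a1) a =
    sweedler H (\<lambda>a1 a2. sweedler H (\<lambda>b1 b2. f a1 b1 b2) a2) a"
  using sum_list_tensor3_eq[OF assms coassoc, of a]
  by (simp add: sweedler_def sum_list_concat_map case_prod_unfold o_def)

lemma grouplike_inverse:
  assumes "grouplike H u"
  shows "antipode H u * u = 1" "u * antipode H u = 1"
proof -
  interpret S: Vector_Spaces.linear "scl H" "scl H" "antipode H" by (rule antipode_linear)
  have "bilin (scl H) (\<lambda>a b. antipode H a * b)" "bilin (scl H) (\<lambda>a b. a * antipode H b)"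
    by (rule bilinear_mapI;
        simp add: vector_space_axioms ring_distribs scale_mult_left scale_mult_right S.add S.scale)+
  from this[THEN sweedler_grouplike[OF _ assms]]
  show "antipode H u * u = 1" "u * antipode H u = 1"
    using assms antipode_left[of u] antipode_right[of u]
    by (simp_all add: sweedler_def grouplike_def)
qed

lemma unit_inverse_grouplike:
  assumes "grouplike H u"
  shows "unit_inverse u = antipode H u"
  unfolding unit_inverse_def
proof (rule the_equality)
  show "u * antipode H u = 1 \<and> antipode H u * u = 1" using grouplike_inverse[OF assms] by simp
  fix v assume "u * v = 1 \<and> v * u = 1"
  then have "antipode H u * (u * v) = antipode H u" by simp
  then show "v = antipode H u" by (simp add: mult.assoc[symmetric] grouplike_inverse[OF assms])
qed

text \<open>
The inverse of a grouplike element behaves as a grouplike element under every bilinear map: evaluate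
\<open>\<Delta>(u u\<^sup>-\<^sup>1) = 1 \<otimes> 1\<close> on \<open>f\<close> precomposed with multiplication by \<open>u\<^sup>-\<^sup>1\<close> in both factors.
\<close>

lemma sweedler_antipode_grouplike:
  assumes "bilin t f" "grouplike H u"
  shows "sweedler H f (antipode H u) = f (antipode H u) (antipode H u)"
proof -
  let ?v = "antipode H u"
  have *: "?v * (u * k) = k" for k
    by (simp add: mult.assoc[symmetric] grouplike_inverse[OF assms(2)])
  note b = bilin_mult_left[OF assms(1), of ?v ?v]
  show ?thesis
    using sweedler_mult_grouplike[OF b assms(2), of ?v] sweedler_one[OF b]
    by (simp add: grouplike_inverse[OF assms(2)] *)
qed

end


section \<open>Sweedler sums and normal forms in a Hopf-Ore extension\<close>

context hopf_ore_extension
begin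

lemma \<chi>_linear: "\<chi> (a + b) = \<chi> a + \<chi> b" "\<chi> (scl A c a) = c * \<chi> a" "\<chi> (a * b) = \<chi> a * \<chi> b" "\<chi> 1 = 1"
proof -
  interpret \<chi>: k_algebra_hom "scl A" "(*)" \<chi> by (rule \<chi>_character)
  show "\<chi> (a + b) = \<chi> a + \<chi> b" "\<chi> (scl A c a) = c * \<chi> a" "\<chi> (a * b) = \<chi> a * \<chi> b" "\<chi> 1 = 1"
    by (simp_all add: \<chi>.add \<chi>.scale \<chi>.hom_mult \<chi>.hom_one)
qed

abbreviation (input) g_inv where "g_inv \<equiv> antipode A g"

lemma g_inv [simp]: "g_inv * g = 1" "g * g_inv = 1" "unit_inverse g = g_inv"
  using A.grouplike_inverse[OF g_grouplike] A.unit_inverse_grouplike[OF g_grouplike] by auto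

lemma g_inv_cancel [simp]: "g_inv * (g * a) = a" "g * (g_inv * a) = a"
  by (simp_all add: mult.assoc[symmetric])

lemma q_nonzero: "\<chi> g \<noteq> 0"
  using \<chi>_linear(3)[of g g_inv] by (auto simp: \<chi>_linear(4))

lemma \<sigma>_g: "\<sigma> g = scl A (\<chi> g) g"
proof -
  have "A.bilin (scl A) (\<lambda>a b. scl A (\<chi> a) b)"
    by (rule bilinear_mapI)
       (simp_all add: A.vector_space_axioms \<chi>_linear A.scale_left_distrib A.scale_right_distrib mult.commute)
  from A.sweedler_grouplike[OF this g_grouplike] show ?thesis
    using \<sigma>_left[of g] by (simp add: sweedler_def)
qed

text \<open>
This is \<open>\<Delta>(\<sigma>(b)) = \<sigma>(b\<^sub>1) \<otimes> b\<^sub>2\<close>: coassociativity applied to \<open>\<sigma>(b) = \<chi>(b\<^sub>1) b\<^sub>2\<close>. The lemma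
\<open>sweedler_\<sigma>_right\<close> below is its mirror image
\<open>\<Delta>(\<sigma>(b)) = g b\<^sub>1 g\<^sup>-\<^sup>1 \<otimes> \<sigma>(b\<^sub>2)\<close>, from the other description of \<open>\<sigma>\<close>.
\<close>

lemma sweedler_\<sigma>_left:
  assumes f: "A.bilin t f"
  shows "sweedler A f (\<sigma> b) = sweedler A (\<lambda>u v. f (\<sigma> u) v) b"
proof -
  interpret t: vector_space t using f by (rule bilinear_mapD)
  note fD = bilinear_mapD[OF f]
  note lin = linear_scale_map[OF t.vector_space_axioms]
  have tri: "trilinear_map (scl A) t (\<lambda>a b c. t (\<chi> a) (f b c))"
    unfolding trilinear_map_def
    by (intro conjI allI bilinear_mapI)
       (simp_all add: A.vector_space_axioms t.vector_space_axioms \<chi>_linear fD t.scale_left_distrib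
          t.scale_right_distrib mult.commute)
  have "sweedler A f (\<sigma> b) = sweedler A (\<lambda>u v. t (\<chi> u) (sweedler A f v)) b"
    using sweedler_linear_image[OF A.sweedler_linear[OF f], of A "\<lambda>u v. scl A (\<chi> u) v" b]
    by (simp add: \<sigma>_left sweedler_def[of A "\<lambda>u v. scl A (\<chi> u) v"] A.sweedler_scale[OF f])
  also have "\<dots> = sweedler A (\<lambda>u v. sweedler A (\<lambda>v1 v2. t (\<chi> u) (f v1 v2)) v) b"
    by (simp add: sweedler_linear_image[OF lin])
  also have "\<dots> = sweedler A (\<lambda>u v. sweedler A (\<lambda>u1 u2. t (\<chi> u1) (f u2 v)) u) b"
    by (rule A.sweedler_coassoc[OF tri, symmetric])
  also have "\<dots> = sweedler A (\<lambda>u v. f (\<sigma> u) v) b"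
  proof -
    have "Vector_Spaces.linear (scl A) t (\<lambda>u. f u v)" for v
      using f by (simp add: bilinear_map_def)
    from sweedler_linear_image[OF this, of A "\<lambda>u1 u2. scl A (\<chi> u1) u2"]
    show ?thesis
      by (simp add: \<sigma>_left sweedler_def[of A "\<lambda>u v. scl A (\<chi> u) v"] fD)
  qed
  finally show ?thesis .
qed

lemma sweedler_conj_g:
  assumes f: "A.bilin t f"
  shows "sweedler A f (g * c * g_inv) = sweedler A (\<lambda>u v. f (g * u * g_inv) (g * v * g_inv)) c"
proof -
  \<comment> \<open>A factor \<open>g\<close> on the right cancels the conjugation, so only \<open>\<Delta>(g c)\<close> has to be expanded.\<close>
  have f2: "A.bilin t (\<lambda>u v. f (u * g_inv) (v * g_inv))"
    using A.bilin_mult[OF f, of 1 g_inv 1 g_inv] by simp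
  have "sweedler A f (g * c * g_inv) = sweedler A (\<lambda>u v. f (u * g_inv) (v * g_inv)) (g * c * g_inv * g)"
    using A.sweedler_mult_grouplike_right[OF f2 g_grouplike, of "g * c * g_inv"] by (simp add: mult.assoc)
  also have "\<dots> = sweedler A (\<lambda>u v. f (g * u * g_inv) (g * v * g_inv)) c"
    using A.sweedler_mult_grouplike[OF f2 g_grouplike, of c] by (simp add: mult.assoc)
  finally show ?thesis .
qed

lemma sweedler_\<sigma>_right:
  assumes f: "A.bilin t f"
  shows "sweedler A f (\<sigma> b) = sweedler A (\<lambda>u v. f (g * u * g_inv) (\<sigma> v)) b"
proof -
  interpret t: vector_space t using f by (rule bilinear_mapD)
  note fD = bilinear_mapD[OF f]
  note lin = linear_scale_map[OF t.vector_space_axioms]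
  have tri: "trilinear_map (scl A) t (\<lambda>a b c. t (\<chi> c) (f (g * a * g_inv) (g * b * g_inv)))"
    unfolding trilinear_map_def
    by (intro conjI allI bilinear_mapI)
       (simp_all add: A.vector_space_axioms t.vector_space_axioms \<chi>_linear fD t.scale_left_distrib
          t.scale_right_distrib mult.commute ring_distribs A.scale_mult_left A.scale_mult_right)
  have "sweedler A f (\<sigma> b) = sweedler A (\<lambda>u v. t (\<chi> v) (sweedler A f (g * u * g_inv))) b"
    using sweedler_linear_image[OF A.sweedler_linear[OF f], of A "\<lambda>u v. scl A (\<chi> v) (g * u * g_inv)" b]
    by (simp add: \<sigma>_right sweedler_def[of A "\<lambda>u v. scl A (\<chi> v) (g * u * g_inv)"] A.sweedler_scale[OF f])
  also have "\<dots> = sweedler A (\<lambda>u v. sweedler A (\<lambda>u1 u2. t (\<chi> v) (f (g * u1 * g_inv) (g * u2 * g_inv))) u) b"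
    by (simp add: sweedler_linear_image[OF lin] sweedler_conj_g[OF f])
  also have "\<dots> = sweedler A (\<lambda>u v. sweedler A (\<lambda>v1 v2. t (\<chi> v2) (f (g * u * g_inv) (g * v1 * g_inv))) v) b"
    by (rule A.sweedler_coassoc[OF tri])
  also have "\<dots> = sweedler A (\<lambda>u v. f (g * u * g_inv) (\<sigma> v)) b"
  proof -
    have "Vector_Spaces.linear (scl A) t (f u)" for u
      using f by (simp add: bilinear_map_def)
    from sweedler_linear_image[OF this, where H = A and f = "\<lambda>v1 v2. scl A (\<chi> v2) (g * v1 * g_inv)"]
    show ?thesis
      by (simp add: \<sigma>_right sweedler_def[of A "\<lambda>u v. scl A (\<chi> v) (g * u * g_inv)"] fD)
  qed
  finally show ?thesis .
qed

lemma bilin_\<iota>: "H.bilin t f \<Longrightarrow> A.bilin t (\<lambda>u v. f (\<iota> u) (\<iota> v))"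
  by (rule bilinear_mapI)
     (auto simp: A.vector_space_axioms add scale bilinear_mapD(4-) dest: bilinear_mapD(3))

lemma sweedler_\<iota>: "H.bilin t f \<Longrightarrow> sweedler H f (\<iota> a) = sweedler A (\<lambda>u v. f (\<iota> u) (\<iota> v)) a"
  using H.sweedler_cong_tensor[OF _ hom_comult] by (simp add: sweedler_def case_prod_unfold o_def)

lemma sweedler_x:
  "H.bilin t f \<Longrightarrow> sweedler H f x = f x 1 + f (\<iota> g) x"
  using H.sweedler_cong_tensor[OF _ comult_x] by simp

lemma sweedler_x_mult:
  assumes "H.bilin t f"
  shows "sweedler H f (x * k) = sweedler H (\<lambda>k1 k2. f (x * k1) k2 + f (\<iota> g * k1) (x * k2)) k"
  unfolding H.sweedler_mult[OF assms]
  using sweedler_x[OF H.bilin_sweedler_mult[OF assms]] by (simp add: sweedler_add)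

lemma sweedler_g_inv_x:
  assumes f: "H.bilin t f"
  shows "sweedler H f (\<iota> g_inv * x) = f (\<iota> g_inv * x) (\<iota> g_inv) + f 1 (\<iota> g_inv * x)"
proof -
  note b = H.bilin_sweedler_mult[OF f]
  have "sweedler H f (\<iota> g_inv * x) = sweedler H (\<lambda>k1 k2. f (\<iota> g_inv * k1) (\<iota> g_inv * k2)) x"
    unfolding H.sweedler_mult[OF f] sweedler_\<iota>[OF b]
    by (rule A.sweedler_antipode_grouplike[OF bilin_\<iota>[OF b] g_grouplike])
  also have "\<dots> = f (\<iota> g_inv * x) (\<iota> g_inv) + f (\<iota> (g_inv * g)) (\<iota> g_inv * x)"
    using sweedler_x[OF H.bilin_mult_left[OF f]] by (simp add: hom_mult[symmetric])
  finally show ?thesis by (simp add: hom_one)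
qed

lemma sweedler_\<iota>g_mult:
  assumes f: "H.bilin t f"
  shows "sweedler H f (\<iota> g * k) = sweedler H (\<lambda>k1 k2. f (\<iota> g * k1) (\<iota> g * k2)) k"
  unfolding H.sweedler_mult[OF f] sweedler_\<iota>[OF H.bilin_sweedler_mult[OF f]]
  by (rule A.sweedler_grouplike[OF bilin_\<iota>[OF H.bilin_sweedler_mult[OF f]] g_grouplike])

lemma x_\<iota>g: "x * \<iota> g = scl H (\<chi> g) (\<iota> g * x)"
  by (simp add: ore_relation \<sigma>_g scale H.scale_mult_left)

lemma \<iota>g_x: "\<iota> g * x = scl H (inverse (\<chi> g)) (x * \<iota> g)"
  by (simp add: x_\<iota>g q_nonzero)

lemma \<iota>g_monomial: "\<iota> g * (x ^ j * \<iota> a) = scl H (inverse (\<chi> g) ^ j) (x ^ j * \<iota> (g * a))"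
proof (induction j)
  case (Suc j)
  have "\<iota> g * (x ^ Suc j * \<iota> a) = scl H (inverse (\<chi> g)) (x * (\<iota> g * (x ^ j * \<iota> a)))"
    by (simp add: mult.assoc[symmetric] \<iota>g_x H.scale_mult_left)
  then show ?case by (simp add: Suc H.scale_mult_right mult.assoc)
qed (simp add: hom_mult)

text \<open>
Iterating \<open>x \<sigma>\<^sup>-\<^sup>1(a) = a x\<close> gives \<open>b = \<sigma>\<^sup>-\<^sup>j(a)\<close>.
\<close>

lemma \<iota>_x_power: "\<exists>b. \<iota> a * x ^ j = x ^ j * \<iota> b"
proof (induction j arbitrary: a)
  case (Suc j)
  obtain b where b: "\<iota> (inv \<sigma> a) * x ^ j = x ^ j * \<iota> b" using Suc by blast
  have "\<iota> a * x ^ Suc j = (x * \<iota> (inv \<sigma> a)) * x ^ j"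
    by (simp add: ore_relation bij_inv_eq_iff[OF \<sigma>_bij] surj_f_inv_f[OF bij_is_surj[OF \<sigma>_bij]] mult.assoc)
  also have "\<dots> = x ^ Suc j * \<iota> b" by (simp add: mult.assoc b)
  finally show ?case by blast
qed auto

lemma monomial_induct:
  assumes "P 0" "\<And>h k. P h \<Longrightarrow> P k \<Longrightarrow> P (h + k)" "\<And>j a. P (x ^ j * \<iota> a)"
  shows "P h"
proof -
  obtain c :: "nat \<Rightarrow> 'a" where c: "finite {i. c i \<noteq> 0}" "h = (\<Sum>i | c i \<noteq> 0. x ^ i * \<iota> (c i))"
    using normal_form[of h] by blast
  have "P (\<Sum>i\<in>I. x ^ i * \<iota> (c i))" if "finite I" for I
    using that by induction (auto intro: assms)
  then show ?thesis using c by simp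
qed

text \<open>
Multiplication by \<open>g\<close> only rescales \<open>x\<^sup>j a\<close> and changes \<open>a\<close>. Therefore the step from \<open>k\<close> to \<open>x k\<close> may assume the
property for \<open>g k\<close> too, which is the element that appears next to \<open>x k\<close> in \<open>\<Delta>(x k)\<close>.
\<close>

lemma ore_induct [case_names zero add scale base step]:
  assumes "P 0" "\<And>h k. P h \<Longrightarrow> P k \<Longrightarrow> P (h + k)" "\<And>c h. P h \<Longrightarrow> P (scl H c h)"
    and "\<And>a. P (\<iota> a)" "\<And>k. P k \<Longrightarrow> P (\<iota> g * k) \<Longrightarrow> P (x * k)"
  shows "P h"
proof (rule monomial_induct)
  show "P (x ^ j * \<iota> a)" for j a
  proof (induction j arbitrary: a)
    case (Suc j)
    have "P (\<iota> g * (x ^ j * \<iota> a))"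
      unfolding \<iota>g_monomial by (intro assms(3) Suc)
    then show ?case using assms(5)[OF Suc[of a]] by (simp add: mult.assoc)
  qed (simp add: assms(4))
qed (use assms in auto)

end


section \<open>The Gaussian coefficients of the monomial formula\<close>

lemma qbinomial_eq_0: "k > n \<Longrightarrow> qbinomial q n k = 0"
proof (induction n arbitrary: k)
  case 0 then show ?case by (cases k) auto
next
  case (Suc n) then show ?case by (cases k) auto
qed

lemma qbinomial_0 [simp]: "qbinomial q n 0 = 1"
  by (induction n) auto

definition ore_coeff :: "'k::field \<Rightarrow> nat \<Rightarrow> nat \<Rightarrow> 'k"
  where "ore_coeff q j k =
    (-1) ^ k * q powi (- int (k * (k - 1) div 2)) * qbinomial (inverse q) j k"

lemma ore_coeff_0: "ore_coeff q j 0 = 1"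
  by (simp add: ore_coeff_def)

lemma ore_coeff_eq_0: "k > j \<Longrightarrow> ore_coeff q j k = 0"
  by (simp add: ore_coeff_def qbinomial_eq_0)

text \<open>
The Pascal rule for Gaussian coefficients, with the triangular exponents absorbed:
\<open>k (k + 1) / 2 = k (k - 1) / 2 + k\<close> turns the exponent \<open>j - k\<close> of the Pascal rule into \<open>j\<close>.
\<close>

lemma ore_coeff_Suc:
  assumes "k \<le> j"
  shows "ore_coeff q (Suc j) (Suc k) = ore_coeff q j (Suc k) - inverse q ^ j * ore_coeff q j k"
proof -
  have tri: "Suc k * k div 2 = k * (k - 1) div 2 + k"
  proof -
    have "Suc k * k = k * (k - 1) + k * 2" by (cases k) auto
    then show ?thesis by simp
  qed
  have pw: "q powi (- int n) = inverse q ^ n" for n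
    by (simp add: power_int_minus power_inverse)
  have "inverse q ^ (Suc k * k div 2) * inverse q ^ (j - k) = inverse q ^ (k * (k - 1) div 2) * inverse q ^ j"
    using assms by (simp only: tri power_add[symmetric]) (simp add: add.assoc)
  then show ?thesis using assms
    by (simp add: ore_coeff_def pw algebra_simps del: mult_Suc mult_Suc_right)
qed


section \<open>Partial actions of a Hopf-Ore extension\<close>

locale ore_linear_action = hopf_ore_extension A H \<iota> g \<chi> \<sigma> x + R: k_algebra sR
  for A :: "('k::field, 'a::{ring, monoid_mult}) hopf_struct"
    and H :: "('k, 'h::{ring, monoid_mult}) hopf_struct"
    and \<iota> g \<chi> \<sigma> x
    and sR :: "'k \<Rightarrow> 'r::{ring, monoid_mult} \<Rightarrow> 'r" +
  fixes act :: "'h \<Rightarrow> 'r \<Rightarrow> 'r"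
  assumes act_bilinear: "bilinear_map (scl H) sR sR act"
    and w_central: "act x 1 * r = r * act x 1"
    and act_g_one: "act (\<iota> g) 1 = 0"
    and act_g_commute: "act (\<iota> (g * a)) r = act (\<iota> (a * g)) r"
begin

abbreviation (input) w where "w \<equiv> act x 1"
abbreviation (input) q where "q \<equiv> \<chi> g"

lemmas act_linear = bilinear_mapD(4-)[OF act_bilinear]

lemma act_zero [simp]: "act 0 r = 0" "act h 0 = 0"
  using act_linear(1)[of 0 0 r] act_linear(3)[of h 0 0] by simp_all

lemma act_diff: "act h (r - s) = act h r - act h s"
  using act_linear(3)[of h "r - s" s] by (simp_all add: algebra_simps)

text \<open>
The commutation hypothesis moves \<open>g\<close> cyclically around a whole element of \<open>A\<close> only; it does not allow
\<open>g\<close> to be commuted past a factor in the middle of a product.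
\<close>

lemma act_conj_g: "act (\<iota> (g * a * g_inv)) r = act (\<iota> a) r"
  using act_g_commute[of "a * g_inv" r] by (simp add: mult.assoc)

text \<open>
With \<open>b\<close> and \<open>c\<close> equal to \<open>1\<close> or to a fixed \<open>k\<close>, this covers the summands in the product law, the composition
law and the symmetric composition law at once.
\<close>

lemma bilin_act:
  "H.bilin sR (\<lambda>h k. act (h * b) r * act (k * c) s)"
  by (rule bilinear_mapI)
     (simp_all add: H.vector_space_axioms R.vector_space_axioms act_linear ring_distribs
       H.scale_mult_left R.scale_mult_left R.scale_mult_right)

lemmas bilin_act_mult = bilin_act[where b = 1 and c = 1, unfolded mult_1_right]
lemmas bilin_act_comp = bilin_act[where b = 1, unfolded mult_1_right]
lemmas bilin_act_comp_sym = bilin_act[where c = 1, unfolded mult_1_right]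

lemmas sweedler_act_\<iota> = sweedler_\<iota>[OF bilin_act_mult] sweedler_\<iota>[OF bilin_act_comp]
  sweedler_\<iota>[OF bilin_act_comp_sym]

text \<open>
The case \<open>j = 1\<close> of the monomial formula, but for all elements of the Hopf-Ore extension instead of those of
\<open>A\<close>; this makes it equivalent to the formula for all \<open>j\<close>.
\<close>

definition skew_commutator :: bool
  where "skew_commutator \<longleftrightarrow> (\<forall>k r. act (x * k) r = w * act k r - act (\<iota> g * k) r * w)"

lemma skew_commutatorD: "skew_commutator \<Longrightarrow> act (x * k) r = w * (act k r - act (\<iota> g * k) r)"
  by (simp add: skew_commutator_def w_central ring_distribs)

definition ore_formula :: "nat \<Rightarrow> 'a \<Rightarrow> 'r \<Rightarrow> 'r"
  where "ore_formula j a r =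
    (\<Sum>k = 0..j. sR (ore_coeff q j k) (w ^ (j - k) * act (\<iota> (g ^ k * a)) r * w ^ k))"

lemma ore_formula_0: "ore_formula 0 a r = act (\<iota> a) r"
  by (simp add: ore_formula_def ore_coeff_0)

lemma power_shift: "g * (g ^ k * a) = g ^ k * (g * a)"
  by (simp add: power_commutes flip: mult.assoc)

text \<open>
The recursion that the skew commutator law imposes on \<open>x\<^sup>j a \<cdot> r\<close>, because
\<open>g x\<^sup>j a = q\<^sup>-\<^sup>j x\<^sup>j g a\<close>.
\<close>

lemma ore_formula_Suc:
  "ore_formula (Suc j) a r = w * ore_formula j a r - sR (inverse q ^ j) (ore_formula j (g * a) r * w)"
proof -
  let ?t = "\<lambda>k. w ^ (Suc j - k) * act (\<iota> (g ^ k * a)) r * w ^ k"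
  have 1: "w * ore_formula j a r = (\<Sum>k = 0..j. sR (ore_coeff q j k) (?t k))"
    by (simp add: ore_formula_def sum_distrib_left R.scale_mult_right Suc_diff_le mult.assoc)
  \<comment> \<open>The added term has coefficient \<open>0\<close>; it aligns the range with that of the left-hand side.\<close>
  also have "\<dots> = (\<Sum>k = 0..Suc j. sR (ore_coeff q j k) (?t k))"
    by (simp add: ore_coeff_eq_0)
  also have "\<dots> = ?t 0 + (\<Sum>k = 0..j. sR (ore_coeff q j (Suc k)) (?t (Suc k)))"
    by (simp only: sum.atLeast0_atMost_Suc_shift) (simp add: ore_coeff_0)
  finally have 1: "w * ore_formula j a r = \<dots>" .
  have 2: "ore_formula j (g * a) r * w = (\<Sum>k = 0..j. sR (ore_coeff q j k) (?t (Suc k)))"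
    by (simp add: ore_formula_def sum_distrib_right R.scale_mult_left mult.assoc
        power_commutes power_shift)
  have "ore_formula (Suc j) a r = ?t 0 + (\<Sum>k = 0..j. sR (ore_coeff q (Suc j) (Suc k)) (?t (Suc k)))"
    unfolding ore_formula_def
    by (simp only: sum.atLeast0_atMost_Suc_shift) (simp add: ore_coeff_0)
  also have "(\<Sum>k = 0..j. sR (ore_coeff q (Suc j) (Suc k)) (?t (Suc k))) =
      (\<Sum>k = 0..j. sR (ore_coeff q j (Suc k)) (?t (Suc k)))
      - sR (inverse q ^ j) (ore_formula j (g * a) r * w)"
    by (simp add: 2 R.scale_sum_right sum_subtractf[symmetric] ore_coeff_Suc R.scale_left_diff_distrib)
  finally show ?thesis by (simp add: 1)
qed

text \<open>
Monomials \<open>x\<^sup>j a\<close> span, so the law is equivalent to the recursion \<open>ore_formula_Suc\<close> together with the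
starting value at \<open>j = 0\<close>.
\<close>

lemma skew_commutator_iff_formula: "skew_commutator \<longleftrightarrow> (\<forall>a r j. act (x ^ j * \<iota> a) r = ore_formula j a r)"
proof
  assume skew: skew_commutator
  have "act (x ^ j * \<iota> a) r = ore_formula j a r" for j a r
  proof (induction j arbitrary: a)
    case (Suc j)
    have "act (x ^ Suc j * \<iota> a) r = w * act (x ^ j * \<iota> a) r - act (\<iota> g * (x ^ j * \<iota> a)) r * w"
      using skew by (simp add: skew_commutator_def mult.assoc)
    then show ?case
      by (simp add: \<iota>g_monomial act_linear Suc ore_formula_Suc R.scale_mult_left)
  qed (simp add: ore_formula_0)
  then show "\<forall>a r j. act (x ^ j * \<iota> a) r = ore_formula j a r" by blast
next
  assume *: "\<forall>a r j. act (x ^ j * \<iota> a) r = ore_formula j a r"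
  have "act (x * k) r = w * act k r - act (\<iota> g * k) r * w" for k r
  proof (induction k rule: monomial_induct)
    case (3 j a)
    have "act (x * (x ^ j * \<iota> a)) r = ore_formula (Suc j) a r"
      using *[rule_format, of "Suc j" a r] by (simp add: mult.assoc)
    then show ?case
      by (simp add: \<iota>g_monomial act_linear * ore_formula_Suc R.scale_mult_left)
  qed (simp_all add: ring_distribs act_linear)
  then show skew_commutator by (simp add: skew_commutator_def)
qed

lemma partial_action_restrict_iff:
  "partial_action A sR (\<lambda>a. act (\<iota> a)) \<longleftrightarrow>
    (\<forall>r. act 1 r = r) \<and>
    (\<forall>a r s. act (\<iota> a) (r * s) = sweedler A (\<lambda>u v. act (\<iota> u) r * act (\<iota> v) s) a) \<and>
    (\<forall>a b r. act (\<iota> a) (act (\<iota> b) r) = sweedler A (\<lambda>u v. act (\<iota> u) 1 * act (\<iota> v * \<iota> b) r) a)"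
proof -
  have "bilinear_map (scl A) sR sR (\<lambda>a. act (\<iota> a))"
    by (rule bilinear_mapI)
       (simp_all add: A.vector_space_axioms R.vector_space_axioms add scale act_linear)
  then show ?thesis by (simp add: partial_action_def sweedler_def hom_one hom_mult)
qed

lemma partial_action_iff:
  "partial_action H sR act \<longleftrightarrow>
    (\<forall>r. act 1 r = r) \<and>
    (\<forall>h r s. act h (r * s) = sweedler H (\<lambda>h1 h2. act h1 r * act h2 s) h) \<and>
    (\<forall>h k r. act h (act k r) = sweedler H (\<lambda>h1 h2. act h1 1 * act (h2 * k) r) h)"
  by (simp add: partial_action_def sweedler_def act_bilinear)

lemma partial_action_restrict:
  "partial_action H sR act \<Longrightarrow> partial_action A sR (\<lambda>a. act (\<iota> a))"
  by (simp add: partial_action_restrict_iff partial_action_iff sweedler_act_\<iota>)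

text \<open>
The law comes from the element \<open>y = g\<^sup>-\<^sup>1 x\<close>, with \<open>\<Delta>(y) = y \<otimes> g\<^sup>-\<^sup>1 + 1 \<otimes> y\<close> and \<open>y g = q x\<close>: the second
tensor factor \<open>y\<close> comes with \<open>1 \<cdot> 1 = 1\<close>, so the term with \<open>x k\<close> survives in
\<open>y \<cdot> (g k \<cdot> r)\<close>.
\<close>

lemma partial_action_skew_commutator:
  assumes "partial_action H sR act"
  shows skew_commutator
proof -
  have one: "act 1 r = r"
    and mult: "act h (r * s) = sweedler H (\<lambda>h1 h2. act h1 r * act h2 s) h"
    and comp: "act h (act k r) = sweedler H (\<lambda>h1 h2. act h1 1 * act (h2 * k) r) h" for h k r s
    using assms by (auto simp: partial_action_iff)
  have g: "act (\<iota> g) r = 0" for r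
    using mult[of "\<iota> g" 1 r] A.sweedler_grouplike[OF bilin_\<iota>[OF bilin_act_mult] g_grouplike]
    by (simp add: sweedler_act_\<iota> act_g_one)
  have g_inv_one: "act (\<iota> g_inv) 1 = 0"
    using comp[of "\<iota> g_inv" "\<iota> g" 1]
      A.sweedler_antipode_grouplike[OF bilin_\<iota>[OF bilin_act_comp] g_grouplike, of 1 "\<iota> g" 1]
    by (simp add: sweedler_act_\<iota> g one hom_one flip: hom_mult)
  let ?y = "\<iota> g_inv * x"
  have y_comp: "act ?y (act k r) = act ?y 1 * act (\<iota> g_inv * k) r + act (?y * k) r" for k r
    unfolding comp[of ?y] by (simp add: sweedler_g_inv_x[OF bilin_act_comp] one)
  have yg: "?y * (\<iota> g * k) = scl H q (x * k)" for k
  proof -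
    have "?y * (\<iota> g * k) = \<iota> g_inv * (x * \<iota> g) * k" by (simp add: mult.assoc)
    also have "\<dots> = scl H q (\<iota> (g_inv * g) * (x * k))"
      unfolding x_\<iota>g by (simp only: H.scale_mult_left H.scale_mult_right hom_mult mult.assoc)
    finally show ?thesis by (simp add: hom_one)
  qed
  have g_inv_g: "\<iota> g_inv * (\<iota> g * k) = k" for k
    by (simp add: hom_one flip: mult.assoc hom_mult)
  \<comment> \<open>The composition law for \<open>y\<close> and \<open>g\<close>, whose left-hand side is \<open>y \<cdot> (g \<cdot> 1) = 0\<close>.\<close>
  have y1: "act ?y 1 = - sR q w"
    using y_comp[of "\<iota> g * 1" 1] unfolding yg g_inv_g by (simp add: g one act_linear eq_neg_iff_add_eq_0)
  \<comment> \<open>The product law for \<open>s 1\<close>; its first term vanishes because \<open>g\<^sup>-\<^sup>1 \<cdot> 1 = 0\<close>.\<close>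
  have y: "act ?y s = - sR q (s * w)" for s
    using mult[of ?y s 1]
    by (simp add: sweedler_g_inv_x[OF bilin_act_mult] g_inv_one one y1 R.scale_mult_right)
  have "sR q (act (x * k) r) = sR q (w * act k r - act (\<iota> g * k) r * w)" for k r
    using y_comp[of "\<iota> g * k" r] unfolding yg g_inv_g y y1
    by (simp add: act_linear R.scale_mult_left R.scale_right_diff_distrib algebra_simps)
  then show skew_commutator using q_nonzero by (simp add: skew_commutator_def)
qed

text \<open>
For \<open>a = \<sigma>(b)\<close> the composition law for \<open>a\<close> and \<open>x\<close> runs over \<open>g b\<^sub>1 g\<^sup>-\<^sup>1 \<otimes> \<sigma>(b\<^sub>2)\<close>. Moving \<open>x\<close> to the left of \<open>\<sigma>(b\<^sub>2)\<close> and
applying the skew commutator law gives \<open>w (b \<cdot> 1)\<close> minus \<open>w\<close> times a sum in which \<open>g b\<^sub>2\<close> may be replaced by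
\<open>b\<^sub>2 g\<close>; that sum is \<open>b \<cdot> (g \<cdot> 1) = 0\<close>.
Stating the condition for \<open>\<sigma> b\<close> avoids \<open>\<sigma>\<^sup>-\<^sup>1\<close>.
\<close>

lemma partial_action_act_w:
  assumes "partial_action H sR act"
  shows "act (\<iota> (\<sigma> b)) w = act (\<iota> b) 1 * w"
proof -
  have one: "act 1 r = r"
    and mult: "act h (r * s) = sweedler H (\<lambda>h1 h2. act h1 r * act h2 s) h"
    and comp: "act h (act k r) = sweedler H (\<lambda>h1 h2. act h1 1 * act (h2 * k) r) h" for h k r s
    using assms by (auto simp: partial_action_iff)
  have *: "sweedler A (\<lambda>u v. act (\<iota> u) 1 * act (\<iota> v) r) b = act (\<iota> b) r" for b r
    using mult[of "\<iota> b" 1 r] by (simp add: sweedler_act_\<iota>)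
  have "act (\<iota> (\<sigma> b)) w = sweedler A (\<lambda>u v. act (\<iota> (g * u * g_inv)) 1 * act (\<iota> (\<sigma> v) * x) 1) b"
    unfolding comp[of "\<iota> (\<sigma> b)"] sweedler_act_\<iota> by (rule sweedler_\<sigma>_right[OF bilin_\<iota>[OF bilin_act_comp]])
  also have "\<dots> = sweedler A (\<lambda>u v. w * (act (\<iota> u) 1 * act (\<iota> v) 1) - w * (act (\<iota> u) 1 * act (\<iota> v * \<iota> g) 1)) b"
  proof -
    have "act (\<iota> u) 1 * act (x * \<iota> v) 1 =
        w * (act (\<iota> u) 1 * act (\<iota> v) 1) - w * (act (\<iota> u) 1 * act (\<iota> v * \<iota> g) 1)" for u v
    proof -
      have "act (\<iota> u) 1 * (w * s) = w * (act (\<iota> u) 1 * s)" for s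
        by (metis w_central mult.assoc)
      then show ?thesis
        by (simp add: skew_commutatorD[OF partial_action_skew_commutator[OF assms]] act_g_commute right_diff_distrib flip: hom_mult)
    qed
    then show ?thesis by (simp add: act_conj_g flip: ore_relation)
  qed
  also have "\<dots> = w * act (\<iota> b) 1 - w * act (\<iota> b) (act (\<iota> g) 1)"
    unfolding comp[of "\<iota> b"] sweedler_act_\<iota> by (simp add: sweedler_diff * flip: sweedler_mult_left)
  finally show ?thesis by (simp add: act_g_one w_central)
qed

lemma act_\<iota>_\<sigma>_w_mult:
  assumes A: "partial_action A sR (\<lambda>a. act (\<iota> a))"
    and w: "\<And>b. act (\<iota> (\<sigma> b)) w = act (\<iota> b) 1 * w"
  shows "act (\<iota> (\<sigma> b)) (w * s) = w * act (\<iota> b) s"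
proof -
  have mult: "act (\<iota> a) (r * s) = sweedler A (\<lambda>u v. act (\<iota> u) r * act (\<iota> v) s) a" for a r s
    using A by (auto simp: partial_action_restrict_iff)
  have "act (\<iota> (\<sigma> b)) (w * s) = sweedler A (\<lambda>u v. act (\<iota> (\<sigma> u)) w * act (\<iota> v) s) b"
    unfolding mult by (rule sweedler_\<sigma>_left[OF bilin_\<iota>[OF bilin_act_mult]])
  also have "\<dots> = w * sweedler A (\<lambda>u v. act (\<iota> u) 1 * act (\<iota> v) s) b"
    by (simp add: w sweedler_mult_left mult.assoc flip: w_central)
  also have "\<dots> = w * act (\<iota> b) s"
    using mult[of b 1 s] by simp
  finally show ?thesis .
qed

text \<open>
The commutation hypothesis extends to the Hopf-Ore extension only up to the factor \<open>q\<^sup>-\<^sup>j\<close> in degree \<open>j\<close>.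
This is why the inductions below go by degree.
\<close>

lemma act_g_monomial:
  assumes skew_commutator
  shows "act (\<iota> g * (x ^ j * \<iota> a)) r = sR (inverse q ^ j) (act (x ^ j * \<iota> (a * g)) r)"
proof -
  have "act (\<iota> (g ^ k * (g * a))) r = act (\<iota> (g ^ k * (a * g))) r" for k
    using act_g_commute[of "g ^ k * a" r] by (simp add: power_shift mult.assoc)
  then have "ore_formula j (g * a) r = ore_formula j (a * g) r"
    by (simp add: ore_formula_def)
  then show ?thesis
    using assms by (simp add: \<iota>g_monomial act_linear skew_commutator_iff_formula)
qed

lemma act_g_\<iota>_monomial:
  assumes skew_commutator
  shows "act (\<iota> g * (\<iota> v * (x ^ j * \<iota> a))) r = sR (inverse q ^ j) (act (\<iota> v * (x ^ j * \<iota> (a * g))) r)"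
proof -
  obtain b where b: "\<iota> v * x ^ j = x ^ j * \<iota> b" using \<iota>_x_power by blast
  have *: "\<iota> v * (x ^ j * \<iota> c) = x ^ j * \<iota> (b * c)" for c
    by (simp add: b hom_mult flip: mult.assoc)
  show ?thesis unfolding * act_g_monomial[OF assms] by (simp add: mult.assoc)
qed

text \<open>
The expansion of \<open>\<Delta>(x k) = x k\<^sub>1 \<otimes> k\<^sub>2 + g k\<^sub>1 \<otimes> x k\<^sub>2\<close> by the skew commutator law produces
\<open>F(k\<^sub>1, k\<^sub>2) - F(g k\<^sub>1, k\<^sub>2) + F(g k\<^sub>1, k\<^sub>2) - F(g k\<^sub>1, g k\<^sub>2)\<close>, up to the central factor \<open>w\<close>, and the middle terms
cancel.
\<close>

lemma sweedler_act_x_mult: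
  fixes b c r s
  assumes skew: skew_commutator
  defines "F \<equiv> \<lambda>h1 h2. act (h1 * b) r * act (h2 * c) s"
  shows "sweedler H F (x * k) = w * (sweedler H F k - sweedler H F (\<iota> g * k))"
proof -
  have "F (x * k1) k2 + F (\<iota> g * k1) (x * k2) = w * (F k1 k2 - F (\<iota> g * k1) (\<iota> g * k2))" for k1 k2
  proof -
    have "act (\<iota> g * k1 * b) r * (w * t) = w * (act (\<iota> g * k1 * b) r * t)" for t
      by (metis w_central mult.assoc)
    then show ?thesis
      by (simp add: F_def skew_commutatorD[OF skew] mult.assoc) (simp add: algebra_simps)
  qed
  then show ?thesis
    unfolding F_def
    by (simp add: sweedler_x_mult[OF bilin_act] sweedler_\<iota>g_mult[OF bilin_act] sweedler_mult_left
        flip: sweedler_diff)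
qed

text \<open>
Both sides satisfy the same recursion in \<open>x\<close>, so an identity of this shape on \<open>A\<close> holds on the
whole extension. The product law has \<open>b = c = 1\<close>, the composition law \<open>b = 1\<close>, the symmetric one
\<open>c = 1\<close>.
\<close>

lemma act_eq_sweedler_ore_induct:
  assumes skew: skew_commutator
    and base: "\<And>a. act (\<iota> a) t = sweedler A (\<lambda>u v. act (\<iota> u * b) r * act (\<iota> v * c) s) a"
  shows "act h t = sweedler H (\<lambda>h1 h2. act (h1 * b) r * act (h2 * c) s) h" (is "_ = sweedler H ?F h")
proof (induction h rule: ore_induct)
  case zero
  show ?case using H.sweedler_scale[OF bilin_act, of b r c s 0 0] by simp
next
  case (step k)
  show ?case
    by (simp add: sweedler_act_x_mult[OF skew] skew_commutatorD[OF skew] right_diff_distrib flip: step)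
qed (simp_all add: H.sweedler_plus[OF bilin_act] H.sweedler_scale[OF bilin_act] act_linear
      sweedler_\<iota>[OF bilin_act] base)

lemma act_\<iota>_\<sigma>_act_x:
  assumes "skew_commutator"
    and "partial_action A sR (\<lambda>a. act (\<iota> a))"
    and "\<And>b. act (\<iota> (\<sigma> b)) w = act (\<iota> b) 1 * w"
  shows "act (\<iota> (\<sigma> b)) (act (x * k) r) = w * (act (\<iota> b) (act k r) - act (\<iota> b) (act (\<iota> g * k) r))"
  by (simp add: skew_commutatorD[OF assms(1)] act_\<iota>_\<sigma>_w_mult[OF assms(2,3)] act_diff)

lemma \<sigma>_surj: "\<exists>b. a = \<sigma> b"
  using \<sigma>_bij by (metis bij_pointE)

text \<open>
Induction on the degree of \<open>k\<close>. For \<open>a = \<sigma>(b)\<close> both sides at \<open>x k\<close> reduce to \<open>w\<close> times a difference: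
\<open>b \<cdot> (k \<cdot> r) - b \<cdot> (g k \<cdot> r)\<close> on the left, and on the right the same with Sweedler sums of
\<open>b\<^sub>2 k\<close> and \<open>g b\<^sub>2 k\<close>. In the second sum \<open>g\<close> stands on the wrong side of \<open>b\<^sub>2\<close>; moving it cyclically
turns \<open>g b\<^sub>2 k\<close> into \<open>q\<^sup>-\<^sup>j b\<^sub>2 k g\<close>, and the induction hypothesis for \<open>k g\<close>, of the same degree
as \<open>k\<close>, applies.
\<close>

lemma composition_law_base:
  assumes skew: skew_commutator
    and A: "partial_action A sR (\<lambda>a. act (\<iota> a))"
    and w: "\<And>b. act (\<iota> (\<sigma> b)) w = act (\<iota> b) 1 * w"
  shows "act (\<iota> a) (act k r) = sweedler A (\<lambda>u v. act (\<iota> u) 1 * act (\<iota> v * k) r) a"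
proof (induction k rule: monomial_induct)
  case (3 j c)
  show ?case
  proof (induction j arbitrary: a c)
    case 0
    show ?case using A by (simp add: partial_action_restrict_iff)
  next
    case (Suc j)
    obtain b where a: "a = \<sigma> b" using \<sigma>_surj by blast
    let ?k = "x ^ j * \<iota> c"
    have g: "sweedler A (\<lambda>u v. act (\<iota> u) 1 * act (\<iota> g * (\<iota> v * ?k)) r) b = act (\<iota> b) (act (\<iota> g * ?k) r)"
      using sweedler_linear_image[OF linear_scale_map[OF R.vector_space_axioms, of "inverse q ^ j"], of A _ b]
      by (simp add: act_g_\<iota>_monomial[OF skew] act_g_monomial[OF skew] R.scale_mult_right act_linear Suc)
    have "sweedler A (\<lambda>u v. act (\<iota> u) 1 * act (\<iota> v * (x * ?k)) r) (\<sigma> b) =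
        sweedler A (\<lambda>u v. act (\<iota> (g * u * g_inv)) 1 * act (\<iota> (\<sigma> v) * (x * ?k)) r) b"
      by (rule sweedler_\<sigma>_right[OF bilin_\<iota>[OF bilin_act_comp]])
    also have "\<dots> = sweedler A (\<lambda>u v. w * (act (\<iota> u) 1 * act (\<iota> v * ?k) r - act (\<iota> u) 1 * act (\<iota> g * (\<iota> v * ?k)) r)) b"
    proof -
      have "\<iota> (\<sigma> v) * (x * h) = x * (\<iota> v * h)" for v h
        by (simp add: ore_relation flip: mult.assoc)
      moreover have "act (\<iota> u) 1 * (w * s) = w * (act (\<iota> u) 1 * s)" for u s
        by (metis w_central mult.assoc)
      ultimately show ?thesis
        by (simp add: act_conj_g skew_commutatorD[OF skew] right_diff_distrib)
    qed
    also have "\<dots> = w * (act (\<iota> b) (act ?k r) - act (\<iota> b) (act (\<iota> g * ?k) r))"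
      by (simp add: sweedler_diff g Suc flip: sweedler_mult_left)
    finally show ?case
      by (simp add: a mult.assoc act_\<iota>_\<sigma>_act_x[OF assms])
  qed
qed (simp_all add: act_linear ring_distribs sweedler_add)

text \<open>
The argument of \<open>composition_law_base\<close>, with \<open>\<Delta>(\<sigma>(b)) = \<sigma>(b\<^sub>1) \<otimes> b\<^sub>2\<close> in place of its mirror image, since \<open>x\<close> now
meets the first tensor factor.
\<close>

lemma symmetric_composition_law_base:
  assumes skew: skew_commutator
    and A: "symmetric_partial_action A sR (\<lambda>a. act (\<iota> a))"
    and w: "\<And>b. act (\<iota> (\<sigma> b)) w = act (\<iota> b) 1 * w"
  shows "act (\<iota> a) (act k r) = sweedler A (\<lambda>u v. act (\<iota> u * k) r * act (\<iota> v) 1) a"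
proof (induction k rule: monomial_induct)
  case (3 j c)
  show ?case
  proof (induction j arbitrary: a c)
    case 0
    show ?case using A by (simp add: symmetric_partial_action_def sweedler_def hom_mult)
  next
    case (Suc j)
    obtain b where a: "a = \<sigma> b" using \<sigma>_surj by blast
    let ?k = "x ^ j * \<iota> c"
    have g: "sweedler A (\<lambda>u v. act (\<iota> g * (\<iota> u * ?k)) r * act (\<iota> v) 1) b = act (\<iota> b) (act (\<iota> g * ?k) r)"
      using sweedler_linear_image[OF linear_scale_map[OF R.vector_space_axioms, of "inverse q ^ j"], of A _ b]
      by (simp add: act_g_\<iota>_monomial[OF skew] act_g_monomial[OF skew] R.scale_mult_left act_linear Suc)
    have "sweedler A (\<lambda>u v. act (\<iota> u * (x * ?k)) r * act (\<iota> v) 1) (\<sigma> b) =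
        sweedler A (\<lambda>u v. act (\<iota> (\<sigma> u) * (x * ?k)) r * act (\<iota> v) 1) b"
      by (rule sweedler_\<sigma>_left[OF bilin_\<iota>[OF bilin_act_comp_sym]])
    also have "\<dots> = sweedler A (\<lambda>u v. w * (act (\<iota> u * ?k) r * act (\<iota> v) 1 - act (\<iota> g * (\<iota> u * ?k)) r * act (\<iota> v) 1)) b"
    proof -
      have "\<iota> (\<sigma> v) * (x * h) = x * (\<iota> v * h)" for v h
        by (simp add: ore_relation flip: mult.assoc)
      then show ?thesis
        by (simp add: skew_commutatorD[OF skew] right_diff_distrib left_diff_distrib mult.assoc)
    qed
    also have "\<dots> = w * (act (\<iota> b) (act ?k r) - act (\<iota> b) (act (\<iota> g * ?k) r))"
      by (simp add: sweedler_diff g Suc flip: sweedler_mult_left)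
    finally show ?case
      using A by (simp add: a mult.assoc act_\<iota>_\<sigma>_act_x[OF skew _ w] symmetric_partial_action_def)
  qed
qed (simp_all add: act_linear ring_distribs sweedler_add)

lemma partial_action_ore_iff:
  "partial_action H sR act \<longleftrightarrow>
    partial_action A sR (\<lambda>a. act (\<iota> a)) \<and> (\<forall>b. act (\<iota> (\<sigma> b)) w = act (\<iota> b) 1 * w) \<and> skew_commutator"
proof
  assume *: "partial_action A sR (\<lambda>a. act (\<iota> a)) \<and> (\<forall>b. act (\<iota> (\<sigma> b)) w = act (\<iota> b) 1 * w) \<and> skew_commutator"
  then have A: "partial_action A sR (\<lambda>a. act (\<iota> a))"
    and w: "\<And>b. act (\<iota> (\<sigma> b)) w = act (\<iota> b) 1 * w" and skew: skew_commutator by auto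
  show "partial_action H sR act"
    unfolding partial_action_iff
  proof (intro conjI allI)
    show "act 1 r = r" for r using A by (simp add: partial_action_restrict_iff)
    show "act h (r * s) = sweedler H (\<lambda>h1 h2. act h1 r * act h2 s) h" for h r s
      using act_eq_sweedler_ore_induct[OF skew, of "r * s" 1 r 1 s h] A
      by (simp add: partial_action_restrict_iff)
    show "act h (act k r) = sweedler H (\<lambda>h1 h2. act h1 1 * act (h2 * k) r) h" for h k r
      using act_eq_sweedler_ore_induct[OF skew, of "act k r" 1 1 k r h] composition_law_base[OF skew A w]
      by simp
  qed
qed (blast intro: partial_action_restrict partial_action_act_w partial_action_skew_commutator)

lemma symmetric_partial_action_ore_iff:
  "symmetric_partial_action H sR act \<longleftrightarrow>
    symmetric_partial_action A sR (\<lambda>a. act (\<iota> a)) \<and> (\<forall>b. act (\<iota> (\<sigma> b)) w = act (\<iota> b) 1 * w) \<and> skew_commutator"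
proof
  assume *: "symmetric_partial_action A sR (\<lambda>a. act (\<iota> a)) \<and> (\<forall>b. act (\<iota> (\<sigma> b)) w = act (\<iota> b) 1 * w) \<and> skew_commutator"
  then have A: "symmetric_partial_action A sR (\<lambda>a. act (\<iota> a))"
    and w: "\<And>b. act (\<iota> (\<sigma> b)) w = act (\<iota> b) 1 * w" and skew: skew_commutator by auto
  have "act h (act k r) = sweedler H (\<lambda>h1 h2. act (h1 * k) r * act h2 1) h" for h k r
    using act_eq_sweedler_ore_induct[OF skew, of "act k r" k r 1 1 h] symmetric_composition_law_base[OF skew A w]
    by simp
  moreover have "partial_action H sR act"
    using * by (simp add: partial_action_ore_iff symmetric_partial_action_def)
  ultimately show "symmetric_partial_action H sR act"
    by (simp add: symmetric_partial_action_def sweedler_def)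
next
  assume *: "symmetric_partial_action H sR act"
  then have "act h (act k r) = sweedler H (\<lambda>h1 h2. act (h1 * k) r * act h2 1) h" for h k r
    by (simp add: symmetric_partial_action_def sweedler_def)
  then have "act (\<iota> a) (act (\<iota> b) r) = sweedler A (\<lambda>u v. act (\<iota> (u * b)) r * act (\<iota> v) 1) a" for a b r
    by (simp add: sweedler_act_\<iota> hom_mult)
  moreover have "partial_action H sR act"
    using * by (simp add: symmetric_partial_action_def)
  then have "partial_action A sR (\<lambda>a. act (\<iota> a)) \<and> (\<forall>b. act (\<iota> (\<sigma> b)) w = act (\<iota> b) 1 * w) \<and> skew_commutator"
    by (rule iffD1[OF partial_action_ore_iff])
  ultimately show "symmetric_partial_action A sR (\<lambda>a. act (\<iota> a)) \<and>
      (\<forall>b. act (\<iota> (\<sigma> b)) w = act (\<iota> b) 1 * w) \<and> skew_commutator"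
    unfolding symmetric_partial_action_def sweedler_def by blast
qed

end


theorem theorem4p3:
  fixes A :: "('k::{alg_closed_field, field_char_0}, 'a::{ring, monoid_mult}) hopf_struct"
    and H :: "('k, 'h::{ring, monoid_mult}) hopf_struct"
    and \<iota> :: "'a \<Rightarrow> 'h" and g :: 'a and \<chi> :: "'a \<Rightarrow> 'k" and \<sigma> :: "'a \<Rightarrow> 'a" and x :: 'h
    and sR :: "'k \<Rightarrow> 'r::{ring, monoid_mult} \<Rightarrow> 'r"
    and act :: "'h \<Rightarrow> 'r \<Rightarrow> 'r"
  assumes "hopf_ore_extension A H \<iota> g \<chi> \<sigma> x"
    and "k_algebra sR"
    and "bilinear_map (scl H) sR sR act"
    and "\<forall>r. act x 1 * r = r * act x 1"
    and "act (\<iota> g) 1 = 0"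
    and "\<forall>a r. act (\<iota> (g * a)) r = act (\<iota> (a * g)) r"
  shows
    "(partial_action H sR act \<longleftrightarrow>
        partial_action A sR (\<lambda>a. act (\<iota> a)) \<and>
        (\<forall>a. act (\<iota> a) (act x 1) = act (\<iota> (inv \<sigma> a)) 1 * act x 1) \<and>
        (\<forall>a r j. act (x ^ j * \<iota> a) r =
          (\<Sum>k = 0..j. sR ((-1) ^ k * \<chi> g powi (- int (k * (k - 1) div 2)) * qbinomial (inverse (\<chi> g)) j k)
             (act x 1 ^ (j - k) * act (\<iota> (g ^ k * a)) r * act x 1 ^ k)))) \<and>
     (symmetric_partial_action H sR act \<longleftrightarrow>
        symmetric_partial_action A sR (\<lambda>a. act (\<iota> a)) \<and>
        (\<forall>a. act (\<iota> a) (act x 1) = act (\<iota> (inv \<sigma> a)) 1 * act x 1) \<and>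
        (\<forall>a r j. act (x ^ j * \<iota> a) r =
          (\<Sum>k = 0..j. sR ((-1) ^ k * \<chi> g powi (- int (k * (k - 1) div 2)) * qbinomial (inverse (\<chi> g)) j k)
             (act x 1 ^ (j - k) * act (\<iota> (g ^ k * a)) r * act x 1 ^ k))))"
proof -
  interpret ore_linear_action A H \<iota> g \<chi> \<sigma> x sR act
    using assms by (intro ore_linear_action.intro ore_linear_action_axioms.intro) auto
  have w: "(\<forall>a. act (\<iota> a) (act x 1) = act (\<iota> (inv \<sigma> a)) 1 * act x 1) \<longleftrightarrow>
      (\<forall>b. act (\<iota> (\<sigma> b)) (act x 1) = act (\<iota> b) 1 * act x 1)"
    using \<sigma>_bij by (metis bij_inv_eq_iff)
  have formula: "(\<forall>a r j. act (x ^ j * \<iota> a) r =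
      (\<Sum>k = 0..j. sR ((-1) ^ k * \<chi> g powi (- int (k * (k - 1) div 2)) * qbinomial (inverse (\<chi> g)) j k)
        (act x 1 ^ (j - k) * act (\<iota> (g ^ k * a)) r * act x 1 ^ k))) \<longleftrightarrow> skew_commutator"
    unfolding skew_commutator_iff_formula ore_formula_def ore_coeff_def ..
  show ?thesis
    unfolding w formula partial_action_ore_iff symmetric_partial_action_ore_iff by blast
qed

end
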